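(* For any classical Undirected Geography position, its outcome class in classical Undirected Geography equals its outcome class as a position of Quantum Undirected Geography with quantum flavor D and superposition width $2$.
   Context: Undirected Geography: a position consists of an undirected graph $G=(V,E)$, a set of visited vertices, and a current vertex (the token's location, which is visited). A move is labelled by a vertex $v$; it is feasible iff $v$ is adjacent to the current vertex and unvisited, and it moves the token to $v$ and marks $v$ visited. The game is impartial; under normal play a player with no feasible move loses. Outcome classes: $\mathcal N$ (next player wins), $\mathcal P$ (previous player wins). Quantum lift with width $2$: a quantum move is $\langle v_1\mid v_2\rangle$ for distinct move labels; quantum positions are superpositions of distinct classical positions (realizations). A classical move $v$ maps $\langle b_1\mid\cdots\mid b_s\rangle$ to the superposition of the distinct results of $v$ over realizations where $v$ is feasible (others collapse); a quantum move $\langle v_1\mid v_2\rangle$ maps it to the superposition of distinct results of $v_j$ applied to $b_i$ over all feasible pairs. A quantum move is legal only if each of $v_1,v_2$ is feasible in some realization; a classical move is legal only if feasible in some realization. Flavor D: any legal classical or quantum move may be played; a player with no legal move loses. *)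

theory Defs
  imports Main
begin

subsection \<open>Outcome classes of impartial games under normal play\<close>

datatype outcome = N_class | P_class

inductive has_outcome :: "('p \<Rightarrow> 'p set) \<Rightarrow> 'p \<Rightarrow> outcome \<Rightarrow> bool" for opts where
  N: "q \<in> opts p \<Longrightarrow> has_outcome opts q P_class \<Longrightarrow> has_outcome opts p N_class"
| P: "(\<And>q. q \<in> opts p \<Longrightarrow> has_outcome opts q N_class) \<Longrightarrow> has_outcome opts p P_class"

text \<open>The description is proper whenever all plays from \<open>p\<close> are finite; see
  \<open>ug_outcome_class\<close> and \<open>qug_outcome_class\<close> below.\<close>

definition outcome_class :: "('p \<Rightarrow> 'p set) \<Rightarrow> 'p \<Rightarrow> outcome" where
  "outcome_class opts p = (THE c. has_outcome opts p c)"


subsection \<open>Rulesets and their quantum lift of width 2, flavor D\<close>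

text \<open>A ruleset is given by \<open>step b v\<close>: the position reached from \<open>b\<close> by the move labelled \<open>v\<close>,
  or \<open>None\<close> if \<open>v\<close> is not feasible in \<open>b\<close>. A superposition of distinct realizations is the set
  of these realizations.\<close>

definition feasible :: "('p \<Rightarrow> 'm \<Rightarrow> 'p option) \<Rightarrow> 'p \<Rightarrow> 'm \<Rightarrow> bool" where
  "feasible step b v \<longleftrightarrow> step b v \<noteq> None"

definition classical_opts :: "('p \<Rightarrow> 'm \<Rightarrow> 'p option) \<Rightarrow> 'p \<Rightarrow> 'p set" where
  "classical_opts step b = {the (step b v) | v. feasible step b v}"

datatype 'm qmove = Classical 'm | Quantum 'm 'm

fun legal_D :: "('p \<Rightarrow> 'm \<Rightarrow> 'p option) \<Rightarrow> 'p set \<Rightarrow> 'm qmove \<Rightarrow> bool" where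
  "legal_D step B (Classical v) \<longleftrightarrow> (\<exists>b\<in>B. feasible step b v)"
| "legal_D step B (Quantum v1 v2) \<longleftrightarrow>
     v1 \<noteq> v2 \<and> (\<exists>b\<in>B. feasible step b v1) \<and> (\<exists>b\<in>B. feasible step b v2)"

fun qresult :: "('p \<Rightarrow> 'm \<Rightarrow> 'p option) \<Rightarrow> 'p set \<Rightarrow> 'm qmove \<Rightarrow> 'p set" where
  "qresult step B (Classical v) = {the (step b v) | b. b \<in> B \<and> feasible step b v}"
| "qresult step B (Quantum v1 v2) =
     {the (step b v) | b v. b \<in> B \<and> v \<in> {v1, v2} \<and> feasible step b v}"

definition quantum_opts_D :: "('p \<Rightarrow> 'm \<Rightarrow> 'p option) \<Rightarrow> 'p set \<Rightarrow> 'p set set" where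
  "quantum_opts_D step B = {qresult step B m | m. legal_D step B m}"


subsection \<open>Undirected Geography\<close>

definition simple_graph :: "'a set \<Rightarrow> 'a set set \<Rightarrow> bool" where
  "simple_graph V E \<longleftrightarrow> finite V \<and> (\<forall>e\<in>E. e \<subseteq> V \<and> card e = 2)"

datatype 'a ug_position = UG (visited: "'a set") (token: 'a)

definition ug_position :: "'a set \<Rightarrow> 'a ug_position \<Rightarrow> bool" where
  "ug_position V p \<longleftrightarrow> visited p \<subseteq> V \<and> token p \<in> visited p"

definition ug_step :: "'a set set \<Rightarrow> 'a ug_position \<Rightarrow> 'a \<Rightarrow> 'a ug_position option" where
  "ug_step E p v =
     (if {token p, v} \<in> E \<and> v \<notin> visited p then Some (UG (insert v (visited p)) v) else None)"


subsection \<open>Outcome classes of Undirected Geography are well defined\<close>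

lemma has_outcome_unique:
  assumes "has_outcome opts p c" "has_outcome opts p d"
  shows "c = d"
  using assms
proof (induction arbitrary: d rule: has_outcome.induct)
  case (N q p)
  show ?case
    using N.prems by (cases rule: has_outcome.cases) (use N.hyps N.IH in auto)
next
  case (P p)
  show ?case
    using P.prems by (cases rule: has_outcome.cases) (use P.IH in auto)
qed

lemma has_outcome_exists:
  fixes m :: "'p \<Rightarrow> nat"
  assumes "\<And>p q. q \<in> opts p \<Longrightarrow> m q < m p"
  shows "\<exists>c. has_outcome opts p c"
proof (induction "m p" arbitrary: p rule: less_induct)
  case less
  then have ex: "\<exists>c. has_outcome opts q c" if "q \<in> opts p" for q
    using assms that by blast
  show ?case
  proof (cases "\<exists>q\<in>opts p. has_outcome opts q P_class")
    case True
    then show ?thesis by (blast intro: has_outcome.N)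
  next
    case False
    then have "has_outcome opts q N_class" if "q \<in> opts p" for q
      using ex[OF that] that by (metis outcome.exhaust)
    then show ?thesis by (blast intro: has_outcome.P)
  qed
qed

lemma outcome_class_eq_iff:
  assumes "\<exists>c. has_outcome opts p c"
  shows "outcome_class opts p = c \<longleftrightarrow> has_outcome opts p c"
  using assms unfolding outcome_class_def by (metis has_outcome_unique the_equality)

lemma ug_step_less:
  assumes "simple_graph V E" "feasible (ug_step E) p v"
  shows "card (V - visited (the (ug_step E p v))) < card (V - visited p)"
proof -
  from assms have "v \<in> V - visited p" "finite V"
    by (auto simp: simple_graph_def feasible_def ug_step_def split: if_splits)
  moreover have "visited (the (ug_step E p v)) = insert v (visited p)"
    using assms(2) by (auto simp: feasible_def ug_step_def split: if_splits)
  ultimately show ?thesis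
    by (intro psubset_card_mono) auto
qed

lemma ug_outcome_class:
  assumes "simple_graph V E"
  shows "outcome_class (classical_opts (ug_step E)) p = c \<longleftrightarrow>
         has_outcome (classical_opts (ug_step E)) p c"
proof (intro outcome_class_eq_iff has_outcome_exists)
  show "card (V - visited q) < card (V - visited p)"
    if "q \<in> classical_opts (ug_step E) p" for p q :: "'a ug_position"
    using that ug_step_less[OF assms] by (auto simp: classical_opts_def)
qed

lemma qug_outcome_class:
  assumes "simple_graph V E"
  shows "outcome_class (quantum_opts_D (ug_step E)) B = c \<longleftrightarrow>
         has_outcome (quantum_opts_D (ug_step E)) B c"
proof (intro outcome_class_eq_iff has_outcome_exists)
  define f where "f b = card (V - visited b)" for b :: "'a ug_position"
  fix B C :: "'a ug_position set"
  assume "C \<in> quantum_opts_D (ug_step E) B"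
  then obtain m where m: "legal_D (ug_step E) B m" "C = qresult (ug_step E) B m"
    by (auto simp: quantum_opts_D_def)
  have finV: "finite V"
    using assms by (simp add: simple_graph_def)
  have fin: "finite (f ` A)" for A
    by (rule finite_subset[of _ "{..card V}"]) (use finV in \<open>auto simp: f_def intro: card_mono\<close>)
  have ne: "C \<noteq> {}"
    using m by (cases m) auto
  have less: "\<exists>b\<in>B. f c < f b" if "c \<in> C" for c
    using that m(2) ug_step_less[OF assms] by (cases m) (auto simp: f_def)
  have "Max (f ` C) \<in> f ` C"
    using ne fin by (intro Max_in) auto
  then obtain c b where "Max (f ` C) = f c" "b \<in> B" "f c < f b"
    using less by blast
  moreover have "f b \<le> Max (f ` B)"
    using fin \<open>b \<in> B\<close> by (intro Max_ge) auto
  ultimately show "Max ((\<lambda>b. card (V - visited b)) ` C) < Max ((\<lambda>b. card (V - visited b)) ` B)"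
    by (simp add: f_def)
qed

end

theory Submission
  imports Defs "HOL-Library.Disjoint_Sets" "HOL-Combinatorics.Transposition"
begin

text \<open>
  A classical position is in \<open>\<P>\<close> iff every unvisited neighbour of the token is essential, that
  is, covered by every maximum matching of the graph induced on the unvisited vertices: the second
  player answers each move along a maximum matching. If some neighbour is not essential, moving
  there yields such a position, and this classical move is available in the quantum game too.
  It remains to see that quantum moves do not help the loser.

  When the loser plays \<open>\<langle>a | b\<rangle>\<close>, the winner answers with a classical move to a vertex \<open>c\<close>
  matched to \<open>a\<close> in some maximum matching. If no realization with the token on \<open>b\<close> survives this,
  the position behaves as if \<open>a\<close> had been played classically; likewise with \<open>a\<close> and \<open>b\<close>
  exchanged. If no such collapsing answer exists, then exchanging the partners of \<open>a\<close> and \<open>b\<close>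
  turns maximum matchings into maximum matchings, so \<open>a\<close> and \<open>b\<close> are indistinguishable for the
  matching structure. After the answer \<open>c\<close> one of the two is visited, and it does not matter
  which: the two become the possible labels of a single abstract vertex, a slot.
\<close>

section \<open>Maximum matchings\<close>

text \<open>\<open>G\<close> is an arbitrary set family because graphs are later pulled back along
  labellings that are only controlled on \<open>H\<close>. Sets of \<open>G\<close> not contained in
  \<open>H\<close> never enter a matching.\<close>

definition matching :: "'a set set \<Rightarrow> 'a set \<Rightarrow> 'a set set \<Rightarrow> bool" where
  "matching G H N \<longleftrightarrow> N \<subseteq> G \<and> \<Union>N \<subseteq> H \<and> disjoint N"

definition max_matchings :: "'a set set \<Rightarrow> 'a set \<Rightarrow> 'a set set set" where
  "max_matchings G H = {N. matching G H N \<and> (\<forall>N'. matching G H N' \<longrightarrow> card N' \<le> card N)}"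

text \<open>The link of \<open>e\<close> in the hypergraph sense, with edges as the points and
  matchings as the hyperedges.\<close>

definition link :: "'a set \<Rightarrow> 'a set set set \<Rightarrow> 'a set set set" where
  "link e \<M> = (\<lambda>N. N - {e}) ` {N \<in> \<M>. e \<in> N}"

lemma matching_finite:
  assumes "finite H" "matching G H N"
  shows "finite N"
proof -
  have "N \<subseteq> Pow H" using assms(2) by (auto simp: matching_def)
  then show ?thesis using assms(1) by (simp add: finite_subset)
qed

lemma max_matchings_nonempty:
  assumes "finite H"
  shows "max_matchings G H \<noteq> {}"
proof -
  have fin: "finite {N. matching G H N}"
    by (rule finite_subset[of _ "Pow (Pow H)"]) (use assms in \<open>auto simp: matching_def\<close>)
  have "{N. matching G H N} \<noteq> {}"
    by (auto simp: matching_def intro!: exI[of _ "{}"])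
  then have "Max (card ` {N. matching G H N}) \<in> card ` {N. matching G H N}"
    using fin by (intro Max_in) auto
  then obtain N where N: "matching G H N" "card N = Max (card ` {N. matching G H N})"
    by auto
  then have "N \<in> max_matchings G H"
    using fin by (auto simp: max_matchings_def)
  then show ?thesis by blast
qed

lemma max_matchings_cong:
  assumes "\<And>e. e \<subseteq> H \<Longrightarrow> e \<in> G \<longleftrightarrow> e \<in> G'"
  shows "max_matchings G H = max_matchings G' H"
proof -
  have "matching G H N \<longleftrightarrow> matching G' H N" for N
    using assms unfolding matching_def by blast
  then show ?thesis by (simp add: max_matchings_def)
qed

lemma matching_insert:
  assumes "matching G K N" "finite H" "K \<subseteq> H" "e \<in> G" "e \<subseteq> H" "e \<noteq> {}" "e \<inter> \<Union>N = {}"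
  shows "matching G H (insert e N)" "card (insert e N) = Suc (card N)"
proof -
  show "matching G H (insert e N)"
    using assms by (auto simp: matching_def disjoint_def)
  have "e \<notin> N" using assms by auto
  moreover have "finite N"
    using assms by (meson finite_subset matching_finite)
  ultimately show "card (insert e N) = Suc (card N)" by simp
qed

section \<open>Deleting a matching edge or an exposed vertex\<close>

text \<open>Since \<open>e\<close> lies in some maximum matching, the matching numbers of
  \<open>H\<close> and \<open>H - e\<close> differ by exactly one. Adding and removing
  \<open>e\<close> therefore preserve maximality.\<close>

lemma max_matchings_delete_edge:
  assumes "finite H" "N0 \<in> max_matchings G H" "e \<in> N0" "e \<noteq> {}"
  shows "max_matchings G (H - e) = link e (max_matchings G H)"
proof -
  have N0: "matching G H N0" and le: "\<And>N. matching G H N \<Longrightarrow> card N \<le> card N0"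
    using assms(2) by (auto simp: max_matchings_def)
  have del: "matching G (H - e) (N - {e})" "Suc (card (N - {e})) = card N"
    if "matching G H N" "e \<in> N" for N
  proof -
    show "matching G (H - e) (N - {e})"
      using that unfolding matching_def disjoint_def by blast
    show "Suc (card (N - {e})) = card N"
      using matching_finite[OF assms(1) that(1)] that(2) by (rule card_Suc_Diff1)
  qed
  have e: "e \<in> G" "e \<subseteq> H"
    using N0 assms(3) by (auto simp: matching_def)
  have ins: "matching G H (insert e N)" "card (insert e N) = Suc (card N)" "e \<notin> N"
    if "matching G (H - e) N" for N
  proof -
    have *: "e \<inter> \<Union>N = {}" using that by (auto simp: matching_def)
    show "matching G H (insert e N)" "card (insert e N) = Suc (card N)"
      using matching_insert[OF that assms(1) _ e assms(4) *] by auto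
    show "e \<notin> N" using * assms(4) by auto
  qed
  show ?thesis
  proof (intro set_eqI iffI)
    fix N assume N: "N \<in> max_matchings G (H - e)"
    then have m: "matching G (H - e) N" by (simp add: max_matchings_def)
    have "card (N0 - {e}) \<le> card N"
      using N del(1)[OF N0 assms(3)] by (simp add: max_matchings_def)
    then have "card N0 \<le> card (insert e N)"
      using del(2)[OF N0 assms(3)] ins(2)[OF m] by simp
    then have "insert e N \<in> max_matchings G H"
      using ins(1)[OF m] le by (auto simp: max_matchings_def intro: order_trans)
    moreover have "N = insert e N - {e}" using ins(3)[OF m] by simp
    ultimately show "N \<in> link e (max_matchings G H)"
      unfolding link_def by blast
  next
    fix N assume "N \<in> link e (max_matchings G H)"
    then obtain N1 where N1: "N1 \<in> max_matchings G H" "e \<in> N1" "N = N1 - {e}"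
      by (auto simp: link_def)
    then have m: "matching G H N1" by (simp add: max_matchings_def)
    have "card N' \<le> card N" if "matching G (H - e) N'" for N'
    proof -
      have "card (insert e N') \<le> card N1"
        using N1(1) ins(1)[OF that] by (simp add: max_matchings_def)
      then show ?thesis using ins(2)[OF that] del(2)[OF m N1(2)] N1(3) by simp
    qed
    then show "N \<in> max_matchings G (H - e)"
      using del(1)[OF m N1(2)] N1(3) by (simp add: max_matchings_def)
  qed
qed

text \<open>If \<open>N\<close> missed \<eta>, then \<open>N\<close> with the edge from \<gamma> to
  \<eta> would be a maximum matching of \<open>H\<close> that misses \<alpha>. In the game this
  restores the invariant after a move to \<alpha> and the reply \<gamma>.\<close>

lemma max_matchings_delete_edge_covers:
  assumes "finite H" "N0 \<in> max_matchings G H" "{\<alpha>, \<gamma>} \<in> N0" "\<alpha> \<noteq> \<gamma>"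
    and ess: "\<And>N. N \<in> max_matchings G H \<Longrightarrow> \<alpha> \<in> \<Union>N"
    and \<eta>: "\<eta> \<in> H - {\<alpha>, \<gamma>}" "{\<gamma>, \<eta>} \<in> G"
    and N: "N \<in> max_matchings G (H - {\<alpha>, \<gamma>})"
  shows "\<eta> \<in> \<Union>N"
proof (rule ccontr)
  assume "\<eta> \<notin> \<Union>N"
  have "N \<in> link {\<alpha>, \<gamma>} (max_matchings G H)"
    using N max_matchings_delete_edge[OF assms(1-3)] by simp
  then obtain N1 where N1: "N1 \<in> max_matchings G H" "{\<alpha>, \<gamma>} \<in> N1" "N = N1 - {{\<alpha>, \<gamma>}}"
    by (auto simp: link_def)
  have m: "matching G (H - {\<alpha>, \<gamma>}) N"
    using N by (simp add: max_matchings_def)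
  have "\<gamma> \<in> H"
    using N1(1,2) by (auto simp: max_matchings_def matching_def)
  have disj: "{\<gamma>, \<eta>} \<inter> \<Union>N = {}"
    using m \<open>\<eta> \<notin> \<Union>N\<close> by (auto simp: matching_def)
  have ins: "matching G H (insert {\<gamma>, \<eta>} N)" "card (insert {\<gamma>, \<eta>} N) = Suc (card N)"
    using matching_insert[OF m assms(1) _ \<eta>(2) _ _ disj] \<eta>(1) \<open>\<gamma> \<in> H\<close> by auto
  have "finite N1"
    using N1(1) matching_finite[OF assms(1)] by (auto simp: max_matchings_def)
  then have "Suc (card N) = card N1"
    using N1(2,3) card_Suc_Diff1 by metis
  then have "insert {\<gamma>, \<eta>} N \<in> max_matchings G H"
    using ins N1(1) by (simp add: max_matchings_def)
  then have "\<alpha> \<in> \<Union>(insert {\<gamma>, \<eta>} N)" by (rule ess)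
  then show False using m \<eta>(1) \<open>\<alpha> \<noteq> \<gamma>\<close> by (auto simp: matching_def)
qed

text \<open>Deleting an exposed vertex keeps the matching number. A maximum matching of the rest
  that missed \<open>x\<close> could be enlarged by the edge from \<open>v\<close> to
  \<open>x\<close>, beyond the maximum for \<open>H\<close>.\<close>

lemma max_matchings_delete_exposed_covers:
  assumes "finite H" "N0 \<in> max_matchings G H" "v \<in> H" "v \<notin> \<Union>N0"
    and x: "x \<in> H - {v}" "{v, x} \<in> G"
    and N: "N \<in> max_matchings G (H - {v})"
  shows "x \<in> \<Union>N"
proof (rule ccontr)
  assume "x \<notin> \<Union>N"
  have m: "matching G (H - {v}) N"
    using N by (simp add: max_matchings_def)
  have "matching G (H - {v}) N0"
    using assms(2,4) by (auto simp: max_matchings_def matching_def)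
  then have "card N0 \<le> card N"
    using N by (simp add: max_matchings_def)
  have disj: "{v, x} \<inter> \<Union>N = {}"
    using m \<open>x \<notin> \<Union>N\<close> by (auto simp: matching_def)
  have "matching G H (insert {v, x} N)" "card (insert {v, x} N) = Suc (card N)"
    using matching_insert[OF m assms(1) _ x(2) _ _ disj] x(1) \<open>v \<in> H\<close> by auto
  then have "Suc (card N) \<le> card N0"
    using assms(2) by (auto simp: max_matchings_def)
  then show False using \<open>card N0 \<le> card N\<close> by simp
qed

section \<open>Maximum matchings under relabelling\<close>

lemma max_matchings_vimage_involution:
  fixes \<sigma> :: "'a \<Rightarrow> 'a"
  assumes "\<And>x. \<sigma> (\<sigma> x) = x"
  shows "N \<in> max_matchings {e. \<sigma> ` e \<in> G} (\<sigma> ` H) \<longleftrightarrow> (`) \<sigma> ` N \<in> max_matchings G H"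
proof -
  have inj: "inj \<sigma>" by (metis assms injI)
  have ii: "\<sigma> ` \<sigma> ` e = e" for e by (simp add: image_image assms)
  have iii: "(`) \<sigma> ` (`) \<sigma> ` M = M" for M by (simp add: image_image assms)
  have card: "card ((`) \<sigma> ` M) = card M" for M
    by (intro card_image inj_onI) (metis ii)
  have "disjoint ((`) \<sigma> ` M) \<longleftrightarrow> disjoint M" for M
  proof -
    have *: "disjoint ((`) \<sigma> ` M)" if "disjoint M" for M
      using that by (auto simp: disjoint_def simp flip: image_Int[OF inj])
    show ?thesis using *[of M] *[of "(`) \<sigma> ` M"] iii by auto
  qed
  moreover have "\<Union>M \<subseteq> \<sigma> ` H \<longleftrightarrow> \<Union>((`) \<sigma> ` M) \<subseteq> H" for M
  proof -
    have "\<Union>((`) \<sigma> ` M) = \<sigma> ` \<Union>M" by blast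
    then show ?thesis by (metis ii image_mono)
  qed
  ultimately have m: "matching {e. \<sigma> ` e \<in> G} (\<sigma> ` H) M \<longleftrightarrow> matching G H ((`) \<sigma> ` M)" for M
    by (auto simp: matching_def)
  have "(\<forall>M. matching {e. \<sigma> ` e \<in> G} (\<sigma> ` H) M \<longrightarrow> card M \<le> card N) \<longleftrightarrow>
        (\<forall>M. matching G H M \<longrightarrow> card M \<le> card N)"
    by (metis m card iii)
  then show ?thesis by (simp add: max_matchings_def m card)
qed


text \<open>Only the edges at \<alpha> and \<beta> change, and they become the two edges assumed in
  \<open>G\<close>. All other edges of \<open>N\<close> avoid both vertices by disjointness, and the
  size is preserved.\<close>

lemma max_matchings_exchange:
  assumes N: "N \<in> max_matchings G H"
    and edges: "{\<alpha>, \<gamma>} \<in> N" "{\<beta>, \<delta>} \<in> N" "\<alpha> \<noteq> \<beta>" "\<alpha> \<noteq> \<gamma>" "\<alpha> \<noteq> \<delta>" "\<beta> \<noteq> \<gamma>" "\<beta> \<noteq> \<delta>"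
    and G: "{\<alpha>, \<delta>} \<in> G" "{\<beta>, \<gamma>} \<in> G"
  shows "(`) (transpose \<alpha> \<beta>) ` N \<in> max_matchings G H"
proof -
  let ?\<sigma> = "transpose \<alpha> \<beta>"
  have m: "N \<subseteq> G" "\<Union>N \<subseteq> H" "disjoint N"
    using N by (auto simp: max_matchings_def matching_def)
  have inj: "inj ?\<sigma>" by (metis injI transpose_involutory)
  have img: "?\<sigma> ` e \<in> G \<and> ?\<sigma> ` e \<subseteq> H" if "e \<in> N" for e
  proof -
    have H: "{\<alpha>, \<beta>, \<gamma>, \<delta>} \<subseteq> H" using m(2) edges(1,2) by auto
    have uniq: "e = f" if "f \<in> N" "x \<in> e" "x \<in> f" for f x
      using m(3) \<open>e \<in> N\<close> that by (auto simp: disjoint_def)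
    consider "e = {\<alpha>, \<gamma>}" | "e = {\<beta>, \<delta>}" | "\<alpha> \<notin> e" "\<beta> \<notin> e"
      using uniq[OF edges(1)] uniq[OF edges(2)] by blast
    then show ?thesis
    proof cases
      case 1
      then have "?\<sigma> ` e = {\<beta>, \<gamma>}" using edges by (auto simp: transpose_def)
      then show ?thesis using G H by simp
    next
      case 2
      then have "?\<sigma> ` e = {\<alpha>, \<delta>}" using edges by (auto simp: transpose_def)
      then show ?thesis using G H by simp
    next
      case 3
      then have "?\<sigma> ` e = e" by (force simp: transpose_def image_iff)
      then show ?thesis using m that by auto
    qed
  qed
  have "disjoint ((`) ?\<sigma> ` N)"
    using m(3) by (auto simp: disjoint_def simp flip: image_Int[OF inj])
  then have "matching G H ((`) ?\<sigma> ` N)"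
    using img by (auto simp: matching_def)
  moreover have "card ((`) ?\<sigma> ` N) = card N"
    by (intro card_image inj_onI) (simp add: inj_image_eq_iff[OF inj])
  ultimately show ?thesis using N by (simp add: max_matchings_def)
qed

lemma link_image:
  assumes "inj \<sigma>" "\<And>N. N \<in> \<M> \<Longrightarrow> (`) \<sigma> ` N \<in> \<M>" "N \<in> link e \<M>"
  shows "(`) \<sigma> ` N \<in> link (\<sigma> ` e) \<M>"
proof -
  obtain N1 where N1: "N1 \<in> \<M>" "e \<in> N1" "N = N1 - {e}"
    using assms(3) by (auto simp: link_def)
  have "inj ((`) \<sigma>)" by (simp add: inj_def inj_image_eq_iff[OF assms(1)])
  then have "(`) \<sigma> ` N = (`) \<sigma> ` N1 - {\<sigma> ` e}"
    using N1(3) by (simp add: image_set_diff)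
  then show ?thesis using N1 assms(2) by (auto simp: link_def)
qed


section \<open>Slotted superpositions\<close>

text \<open>
  \<open>H\<close> is the set of slots, named by vertices for want of another type, and \<open>L h\<close> is the set of
  vertices that may occupy slot \<open>h\<close>. The condition on \<open>\<M>\<close> ranges over all choices of labels, not
  only over those that occur in the superposition; the exchange argument needs a choice that
  combines labels of different realizations.
\<close>

definition slotted ::
  "'a set set \<Rightarrow> 'a set \<Rightarrow> ('a \<Rightarrow> 'a set) \<Rightarrow> 'a \<Rightarrow> 'a set set set \<Rightarrow> bool" where
  "slotted E H L t \<M> \<longleftrightarrow> finite H \<and> disjoint_family_on L H \<and>
     (\<forall>\<tau>\<in>Pi H L. max_matchings {e. \<tau> ` e \<in> E} H = \<M>) \<and>
     (\<forall>h\<in>H. \<forall>v\<in>L h. {t, v} \<in> E \<longrightarrow> (\<forall>N\<in>\<M>. h \<in> \<Union>N))"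

lemma slottedD:
  assumes "slotted E H L t \<M>"
  shows "finite H"
    and "h \<in> H \<Longrightarrow> k \<in> H \<Longrightarrow> v \<in> L h \<Longrightarrow> v \<in> L k \<Longrightarrow> h = k"
    and "\<tau> \<in> Pi H L \<Longrightarrow> max_matchings {e. \<tau> ` e \<in> E} H = \<M>"
    and "h \<in> H \<Longrightarrow> v \<in> L h \<Longrightarrow> {t, v} \<in> E \<Longrightarrow> N \<in> \<M> \<Longrightarrow> h \<in> \<Union>N"
  using assms unfolding slotted_def disjoint_family_on_def by blast+

lemma slotted_section_inj:
  assumes "slotted E H L t \<M>" "\<tau> \<in> Pi H L"
  shows "inj_on \<tau> H"
  using slottedD(2)[OF assms(1)] assms(2) by (fastforce simp: inj_on_def Pi_def)

text \<open>Disjointness of the label sets makes a vertex determine its slot, so an unvisited label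
  of \<open>h\<close> can only be the occupant of \<open>h\<close>.\<close>

lemma slotted_section_eq:
  assumes "slotted E H L t \<M>" "\<tau> \<in> Pi H L" "h \<in> H" "v \<in> L h" "v \<in> \<tau> ` H"
  shows "\<tau> h = v"
  using slottedD(2)[OF assms(1)] assms(2-) by (fastforce simp: Pi_def)

lemma slotted_matched:
  assumes E: "\<And>e. e \<in> E \<Longrightarrow> card e = 2"
    and S: "slotted E H L t \<M>" "\<tau> \<in> Pi H L" "N \<in> \<M>" "\<alpha> \<in> \<Union>N"
  obtains \<gamma> where "{\<alpha>, \<gamma>} \<in> N" "\<alpha> \<noteq> \<gamma>"
proof -
  obtain e where e: "e \<in> N" "\<alpha> \<in> e" using S(4) by blast
  have "N \<in> max_matchings {e. \<tau> ` e \<in> E} H"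
    using slottedD(3)[OF S(1,2)] S(3) by simp
  then have "e \<subseteq> H" "\<tau> ` e \<in> E"
    using e(1) by (auto simp: max_matchings_def matching_def)
  then have "card e = 2"
    using E slotted_section_inj[OF S(1,2)] by (metis card_image inj_on_subset)
  then obtain \<gamma> where "e = {\<alpha>, \<gamma>}" "\<alpha> \<noteq> \<gamma>"
    using e(2) by (auto simp: card_2_iff)
  then show ?thesis using e(1) that by blast
qed

text \<open>Members of \<open>\<M>\<close> are matchings under every section, so their edges become
  edges of \<open>E\<close> whichever labels are chosen. This makes matched partners available as
  replies.\<close>

lemma slotted_edge:
  assumes "slotted E H L t \<M>" "\<tau> \<in> Pi H L" "N \<in> \<M>" "{\<alpha>, \<gamma>} \<in> N"
  shows "\<alpha> \<in> H" "\<gamma> \<in> H" "{\<tau> \<alpha>, \<tau> \<gamma>} \<in> E"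
proof -
  have "N \<in> max_matchings {e. \<tau> ` e \<in> E} H"
    using slottedD(3)[OF assms(1,2)] assms(3) by simp
  then have "N \<subseteq> {e. \<tau> ` e \<in> E}" "\<Union>N \<subseteq> H"
    by (auto simp: max_matchings_def matching_def)
  then have "{\<alpha>, \<gamma>} \<subseteq> H" "\<tau> ` {\<alpha>, \<gamma>} \<in> E"
    using assms(4) by blast+
  then show "\<alpha> \<in> H" "\<gamma> \<in> H" "{\<tau> \<alpha>, \<tau> \<gamma>} \<in> E"
    by simp_all
qed

section \<open>Slots after a move and its reply\<close>

lemma slotted_delete:
  assumes S: "slotted E H L t \<M>" and \<tau>0: "\<tau>0 \<in> Pi H L"
    and N0: "N0 \<in> \<M>" "{\<alpha>, \<gamma>} \<in> N0" "\<alpha> \<noteq> \<gamma>"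
    and ess: "\<And>N. N \<in> \<M> \<Longrightarrow> \<alpha> \<in> \<Union>N"
  shows "slotted E (H - {\<alpha>, \<gamma>}) L (\<tau>0 \<gamma>) (link {\<alpha>, \<gamma>} \<M>)"
  unfolding slotted_def
proof (intro conjI ballI impI)
  show "finite (H - {\<alpha>, \<gamma>})" using slottedD(1)[OF S] by simp
  show "disjoint_family_on L (H - {\<alpha>, \<gamma>})"
    using S by (auto simp: slotted_def disjoint_family_on_def)
  note fin = slottedD(1)[OF S]
  fix \<tau> assume \<tau>: "\<tau> \<in> Pi (H - {\<alpha>, \<gamma>}) L"
  \<comment> \<open>Any labelling of the remaining slots extends to a section of \<open>H\<close>;
    sets inside the remaining slots do not see the extension.\<close>
  let ?\<tau> = "\<tau>(\<alpha> := \<tau>0 \<alpha>, \<gamma> := \<tau>0 \<gamma>)"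
  have sec: "?\<tau> \<in> Pi H L" using \<tau> \<tau>0 by (auto simp: Pi_def)
  have "max_matchings {e. \<tau> ` e \<in> E} (H - {\<alpha>, \<gamma>}) = max_matchings {e. ?\<tau> ` e \<in> E} (H - {\<alpha>, \<gamma>})"
  proof (rule max_matchings_cong)
    fix e assume "e \<subseteq> H - {\<alpha>, \<gamma>}"
    then have "?\<tau> ` e = \<tau> ` e" by (intro image_cong) auto
    then show "e \<in> {e. \<tau> ` e \<in> E} \<longleftrightarrow> e \<in> {e. ?\<tau> ` e \<in> E}" by simp
  qed
  also have "\<dots> = link {\<alpha>, \<gamma>} \<M>"
    using max_matchings_delete_edge[OF fin, of N0 "{e. ?\<tau> ` e \<in> E}" "{\<alpha>, \<gamma>}"]
      slottedD(3)[OF S sec] N0 by simp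
  finally show "max_matchings {e. \<tau> ` e \<in> E} (H - {\<alpha>, \<gamma>}) = link {\<alpha>, \<gamma>} \<M>" .
next
  note fin = slottedD(1)[OF S]
  fix h v N
  assume h: "h \<in> H - {\<alpha>, \<gamma>}" "v \<in> L h" "{\<tau>0 \<gamma>, v} \<in> E" "N \<in> link {\<alpha>, \<gamma>} \<M>"
  \<comment> \<open>Putting \<open>v\<close> on \<open>h\<close> gives a section under which
    \<gamma> and \<open>h\<close> are adjacent, although no realization need have this
    labelling.\<close>
  let ?\<tau> = "\<tau>0(h := v)"
  have mm: "max_matchings {e. ?\<tau> ` e \<in> E} H = \<M>"
    using h \<tau>0 by (intro slottedD(3)[OF S]) (auto simp: Pi_def)
  have "N \<in> max_matchings {e. ?\<tau> ` e \<in> E} (H - {\<alpha>, \<gamma>})"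
    using max_matchings_delete_edge[OF fin, of N0 "{e. ?\<tau> ` e \<in> E}" "{\<alpha>, \<gamma>}"] mm N0 h(4) by simp
  moreover have "{\<gamma>, h} \<in> {e. ?\<tau> ` e \<in> E}" using h by (auto simp: insert_commute)
  ultimately show "h \<in> \<Union>N"
    using max_matchings_delete_edge_covers[OF fin, of N0 "{e. ?\<tau> ` e \<in> E}" \<alpha> \<gamma> h N] mm N0 ess h(1)
    by blast
qed

text \<open>The merged slot keeps the name \<alpha>. If its label comes from
  \<open>L \<alpha>\<close>, the labelling is a section for \<open>S1\<close>; if it comes from
  \<open>L \<beta>\<close>, swapping the two names gives a section for \<open>S2\<close>, and
  \<open>M\<close> carries the matchings back.\<close>

lemma slotted_merge:
  assumes S1: "slotted E (H - {\<beta>, \<gamma>}) L c \<M>1" and S2: "slotted E (H - {\<alpha>, \<gamma>}) L c \<M>2"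
    and L: "disjoint_family_on L H"
    and H: "\<alpha> \<in> H" "\<beta> \<in> H" "\<alpha> \<noteq> \<beta>" "\<alpha> \<noteq> \<gamma>" "\<beta> \<noteq> \<gamma>"
    and M: "\<And>N. N \<in> \<M>1 \<longleftrightarrow> (`) (transpose \<alpha> \<beta>) ` N \<in> \<M>2"
  shows "slotted E (H - {\<beta>, \<gamma>}) (L(\<alpha> := L \<alpha> \<union> L \<beta>)) c \<M>1"
  unfolding slotted_def
proof (intro conjI ballI impI)
  let ?L = "L(\<alpha> := L \<alpha> \<union> L \<beta>)" and ?\<sigma> = "transpose \<alpha> \<beta>"
  show "finite (H - {\<beta>, \<gamma>})" by (rule slottedD(1)[OF S1])
  show "disjoint_family_on ?L (H - {\<beta>, \<gamma>})"
    using L H unfolding disjoint_family_on_def by (auto split: if_splits)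
  have \<sigma>H: "?\<sigma> ` (H - {\<beta>, \<gamma>}) = H - {\<alpha>, \<gamma>}"
  proof -
    have "?\<sigma> ` (H - {\<beta>, \<gamma>}) = ?\<sigma> ` H - ?\<sigma> ` {\<beta>, \<gamma>}"
      by (intro image_set_diff) (metis injI transpose_involutory)
    also have "?\<sigma> ` {\<beta>, \<gamma>} = {\<alpha>, \<gamma>}" using H by (auto simp: transpose_def)
    also have "?\<sigma> ` H = H" using H by (simp add: transpose_image_eq)
    finally show ?thesis .
  qed
  fix \<tau> assume \<tau>: "\<tau> \<in> Pi (H - {\<beta>, \<gamma>}) ?L"
  have "\<tau> \<alpha> \<in> L \<alpha> \<union> L \<beta>" using \<tau> H by (auto simp: Pi_def)
  then show "max_matchings {e. \<tau> ` e \<in> E} (H - {\<beta>, \<gamma>}) = \<M>1"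
  proof
    assume "\<tau> \<alpha> \<in> L \<alpha>"
    then have "\<tau> \<in> Pi (H - {\<beta>, \<gamma>}) L" using \<tau> by (auto simp: Pi_def split: if_splits)
    then show ?thesis by (rule slottedD(3)[OF S1])
  next
    assume \<tau>\<alpha>: "\<tau> \<alpha> \<in> L \<beta>"
    \<comment> \<open>The swap puts the label of \<alpha> back on its original slot \<beta>.\<close>
    have "\<tau> \<circ> ?\<sigma> \<in> Pi (H - {\<alpha>, \<gamma>}) L"
    proof
      fix h assume h: "h \<in> H - {\<alpha>, \<gamma>}"
      show "(\<tau> \<circ> ?\<sigma>) h \<in> L h"
      proof (cases "h = \<beta>")
        case True
        then show ?thesis using \<tau>\<alpha> by simp
      next
        case False
        then have "\<tau> h \<in> ?L h" using \<tau> h by (intro Pi_mem[OF \<tau>]) auto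
        then show ?thesis using h False by simp
      qed
    qed
    then have "max_matchings {e. (\<tau> \<circ> ?\<sigma>) ` e \<in> E} (H - {\<alpha>, \<gamma>}) = \<M>2"
      by (rule slottedD(3)[OF S2])
    then have M2: "max_matchings {e. ?\<sigma> ` e \<in> {e. \<tau> ` e \<in> E}} (?\<sigma> ` (H - {\<beta>, \<gamma>})) = \<M>2"
      unfolding \<sigma>H by (simp add: image_comp)
    show ?thesis
    proof (rule set_eqI)
      fix N
      have "(`) ?\<sigma> ` (`) ?\<sigma> ` N = N" by (simp add: image_image)
      then show "N \<in> max_matchings {e. \<tau> ` e \<in> E} (H - {\<beta>, \<gamma>}) \<longleftrightarrow> N \<in> \<M>1"
        using max_matchings_vimage_involution[of ?\<sigma> "(`) ?\<sigma> ` N" "{e. \<tau> ` e \<in> E}" "H - {\<beta>, \<gamma>}"] M2 M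
        by simp
    qed
  qed
next
  let ?\<sigma> = "transpose \<alpha> \<beta>"
  fix h v N
  assume h: "h \<in> H - {\<beta>, \<gamma>}" "v \<in> (L(\<alpha> := L \<alpha> \<union> L \<beta>)) h" "{c, v} \<in> E" "N \<in> \<M>1"
  show "h \<in> \<Union>N"
  proof (cases "v \<in> L h")
    case True
    then show ?thesis using slottedD(4)[OF S1 h(1) _ h(3,4)] by simp
  next
    case False
    then have v: "h = \<alpha>" "v \<in> L \<beta>" using h(2) by (auto split: if_splits)
    \<comment> \<open>For a label inherited from \<beta>, coverage is known in \<open>\<M>2\<close>
      at \<beta> and is pulled back to \<alpha>.\<close>
    have "(`) ?\<sigma> ` N \<in> \<M>2" using h(4) M by simp
    then have "\<beta> \<in> \<Union>((`) ?\<sigma> ` N)"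
      using H by (intro slottedD(4)[OF S2 _ v(2) h(3)]) auto
    then obtain e y where "e \<in> N" "y \<in> e" "\<beta> = ?\<sigma> y" by blast
    then show ?thesis using v(1) by (metis UnionI transpose_apply_second transpose_involutory)
  qed
qed


section \<open>The game\<close>

text \<open>Labels form a set so that a classical move is the degenerate quantum move with both
  labels equal.\<close>

definition results :: "'a set set \<Rightarrow> 'a ug_position set \<Rightarrow> 'a set \<Rightarrow> 'a ug_position set" where
  "results E B A = {the (ug_step E b v) | b v. b \<in> B \<and> v \<in> A \<and> feasible (ug_step E) b v}"

text \<open>Sections may vary between realizations, but the token is common: the positions treated
  are single realizations or arise from a classical reply.\<close>

definition realizes ::
  "'a set \<Rightarrow> 'a set \<Rightarrow> ('a \<Rightarrow> 'a set) \<Rightarrow> 'a \<Rightarrow> 'a ug_position set \<Rightarrow> bool" where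
  "realizes V H L t B \<longleftrightarrow> (\<forall>p\<in>B. token p = t \<and> (\<exists>\<tau>\<in>Pi H L. V - visited p = \<tau> ` H))"

lemma feasible_ug_iff: "feasible (ug_step E) p v \<longleftrightarrow> {token p, v} \<in> E \<and> v \<notin> visited p"
  by (simp add: feasible_def ug_step_def)

lemma ug_step_result:
  "feasible (ug_step E) p v \<Longrightarrow> the (ug_step E p v) = UG (insert v (visited p)) v"
  by (simp add: feasible_def ug_step_def split: if_splits)

lemma results_two_steps:
  assumes "q \<in> results E (results E B A) {c}"
  obtains p x where "p \<in> B" "x \<in> A" "{token p, x} \<in> E" "x \<notin> visited p"
    "{x, c} \<in> E" "c \<notin> visited p" "c \<noteq> x" "q = UG (insert c (insert x (visited p))) c"
  using assms unfolding results_def by (auto simp: ug_step_result feasible_ug_iff)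

lemma simple_graph_mem:
  assumes "simple_graph V E" "{x, y} \<in> E"
  shows "x \<in> V" "y \<in> V" "x \<noteq> y"
  using assms by (auto simp: simple_graph_def card_2_iff' dest!: bspec)

section \<open>Classical replies to an arbitrary move\<close>

text \<open>The reply must be legal and restore the slot structure; the drop in the number of slots
  is the induction measure of the game.\<close>

definition good_reply ::
  "'a set \<Rightarrow> 'a set set \<Rightarrow> 'a set \<Rightarrow> 'a ug_position set \<Rightarrow> 'a set \<Rightarrow> bool" where
  "good_reply V E H B A \<longleftrightarrow> (\<exists>c H' L' \<M>'. (\<exists>q\<in>results E B A. feasible (ug_step E) q c) \<and>
     slotted E H' L' c \<M>' \<and> card H' < card H \<and> realizes V H' L' c (results E (results E B A) {c}))"

lemma reply_feasible:
  assumes V: "simple_graph V E" and S: "slotted E H L t \<M>"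
    and p: "p \<in> B" "a \<in> A" "feasible (ug_step E) p a"
    and \<tau>: "\<tau> \<in> Pi H L" "V - visited p = \<tau> ` H" "\<tau> \<alpha> = a"
    and N: "N \<in> \<M>" "{\<alpha>, \<gamma>} \<in> N" "\<alpha> \<noteq> \<gamma>"
  shows "\<exists>q\<in>results E B A. feasible (ug_step E) q (\<tau> \<gamma>)"
proof -
  let ?q = "UG (insert a (visited p)) a"
  have e: "\<alpha> \<in> H" "\<gamma> \<in> H" "{a, \<tau> \<gamma>} \<in> E"
    using slotted_edge[OF S \<tau>(1) N(1,2)] \<tau>(3) by auto
  have "\<tau> \<gamma> \<notin> visited p" using e(2) \<tau>(2) by blast
  moreover have "\<tau> \<gamma> \<noteq> a" using simple_graph_mem(3)[OF V e(3)] by simp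
  ultimately have "feasible (ug_step E) ?q (\<tau> \<gamma>)"
    using e(3) by (simp add: feasible_ug_iff)
  moreover have "?q \<in> results E B A"
    using p ug_step_result[OF p(3)] unfolding results_def by force
  ultimately show ?thesis by blast
qed

text \<open>By \<open>survive\<close>, every realization left after the reply has visited a label of
  \<alpha> and the vertex \<open>\<tau> \<gamma>\<close>. Exactly these two slots are emptied, as if
  the move had been classical.\<close>

lemma reply_delete:
  assumes V: "simple_graph V E" and S: "slotted E H L t \<M>" and R: "realizes V H L t B"
    and p: "p \<in> B" "a \<in> A" "feasible (ug_step E) p a"
    and \<tau>: "\<tau> \<in> Pi H L" "V - visited p = \<tau> ` H" "\<tau> \<alpha> = a"
    and N: "N \<in> \<M>" "{\<alpha>, \<gamma>} \<in> N" "\<alpha> \<noteq> \<gamma>"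
    and survive: "\<And>p x. \<lbrakk>p \<in> B; x \<in> A; {token p, x} \<in> E; x \<notin> visited p;
      {x, \<tau> \<gamma>} \<in> E; \<tau> \<gamma> \<notin> visited p; \<tau> \<gamma> \<noteq> x\<rbrakk> \<Longrightarrow> x \<in> L \<alpha>"
  shows "good_reply V E H B A"
proof -
  have H: "\<alpha> \<in> H" "\<gamma> \<in> H"
    using slotted_edge[OF S \<tau>(1) N(1,2)] by auto
  have "{t, a} \<in> E" using R p by (auto simp: realizes_def feasible_ug_iff)
  moreover have "a \<in> L \<alpha>" using \<tau> H by auto
  ultimately have ess: "\<alpha> \<in> \<Union>N" if "N \<in> \<M>" for N
    using slottedD(4)[OF S H(1)] that by blast
  have "realizes V (H - {\<alpha>, \<gamma>}) L (\<tau> \<gamma>) (results E (results E B A) {\<tau> \<gamma>})"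
    unfolding realizes_def
  proof
    fix q assume "q \<in> results E (results E B A) {\<tau> \<gamma>}"
    then obtain p' x where q: "p' \<in> B" "x \<in> A" "{token p', x} \<in> E" "x \<notin> visited p'"
      "{x, \<tau> \<gamma>} \<in> E" "\<tau> \<gamma> \<notin> visited p'" "\<tau> \<gamma> \<noteq> x"
      "q = UG (insert (\<tau> \<gamma>) (insert x (visited p'))) (\<tau> \<gamma>)"
      by (rule results_two_steps)
    obtain \<tau>' where \<tau>': "\<tau>' \<in> Pi H L" "V - visited p' = \<tau>' ` H"
      using R q(1) by (auto simp: realizes_def)
    have "x \<in> L \<alpha>" using survive q by blast
    then have x: "\<tau>' \<alpha> = x"
      using slotted_section_eq[OF S \<tau>'(1) H(1)] \<tau>'(2) simple_graph_mem[OF V q(3)] q(4) by blast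
    have "\<tau> \<gamma> \<in> L \<gamma>" using \<tau>(1) H(2) by auto
    then have c: "\<tau>' \<gamma> = \<tau> \<gamma>"
      using slotted_section_eq[OF S \<tau>'(1) H(2)] \<tau>'(2) simple_graph_mem[OF V q(5)] q(6) by blast
    have "V - visited q = \<tau>' ` H - \<tau>' ` {\<alpha>, \<gamma>}"
      using q(8) \<tau>'(2) x c by auto
    also have "\<dots> = \<tau>' ` (H - {\<alpha>, \<gamma>})"
      using inj_on_image_set_diff[OF slotted_section_inj[OF S \<tau>'(1)], of H "{\<alpha>, \<gamma>}"] H by auto
    finally show "token q = \<tau> \<gamma> \<and> (\<exists>\<tau>'\<in>Pi (H - {\<alpha>, \<gamma>}) L. V - visited q = \<tau>' ` (H - {\<alpha>, \<gamma>}))"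
      using q(8) \<tau>'(1) by auto
  qed
  moreover have "card (H - {\<alpha>, \<gamma>}) < card H"
    using slottedD(1)[OF S] H by (intro psubset_card_mono) auto
  ultimately show ?thesis
    using slotted_delete[OF S \<tau>(1) N ess] reply_feasible[OF V S p \<tau> N] unfolding good_reply_def by blast
qed

text \<open>Classical moves are the case \<open>a = b\<close>, where disjointness of the label sets
  forces one slot. In the \<open>twins\<close> case \<open>\<M>\<close> is invariant under swapping
  \<alpha> and \<beta>, so either of them can be deleted together with \<gamma> and the other
  becomes the merged slot.\<close>

lemma good_reply_exists:
  assumes V: "simple_graph V E" and S: "slotted E H L t \<M>" and R: "realizes V H L t B"
    and a: "pa \<in> B" "feasible (ug_step E) pa a" and b: "pb \<in> B" "feasible (ug_step E) pb b"
  shows "good_reply V E H B {a, b}"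
proof -
  have E2: "card e = 2" if "e \<in> E" for e using V that by (simp add: simple_graph_def)
  have slot: "\<exists>\<tau> \<alpha>. \<tau> \<in> Pi H L \<and> V - visited p = \<tau> ` H \<and> \<alpha> \<in> H \<and> \<tau> \<alpha> = x \<and> x \<in> L \<alpha> \<and>
      (\<forall>N\<in>\<M>. \<alpha> \<in> \<Union>N)"
    if p: "p \<in> B" "feasible (ug_step E) p x" for p x
  proof -
    obtain \<tau> where \<tau>: "\<tau> \<in> Pi H L" "V - visited p = \<tau> ` H" and t: "token p = t"
      using R p(1) by (auto simp: realizes_def)
    have tx: "{t, x} \<in> E" "x \<notin> visited p" using p(2) t by (auto simp: feasible_ug_iff)
    then have "x \<in> \<tau> ` H" using \<tau>(2) simple_graph_mem[OF V tx(1)] by blast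
    then obtain \<alpha> where \<alpha>: "\<alpha> \<in> H" "\<tau> \<alpha> = x" by blast
    then have "x \<in> L \<alpha>" using \<tau>(1) by auto
    then have "\<forall>N\<in>\<M>. \<alpha> \<in> \<Union>N" using slottedD(4)[OF S \<alpha>(1) _ tx(1)] by blast
    then show ?thesis using \<tau> \<alpha> \<open>x \<in> L \<alpha>\<close> by blast
  qed
  obtain \<tau>0 \<alpha> where \<tau>0: "\<tau>0 \<in> Pi H L" "V - visited pa = \<tau>0 ` H" "\<tau>0 \<alpha> = a"
    and \<alpha>: "\<alpha> \<in> H" "a \<in> L \<alpha>" and ess\<alpha>: "\<And>N. N \<in> \<M> \<Longrightarrow> \<alpha> \<in> \<Union>N"
    using slot[OF a] by blast
  obtain \<tau>1 \<beta> where \<tau>1: "\<tau>1 \<in> Pi H L" "V - visited pb = \<tau>1 ` H" "\<tau>1 \<beta> = b"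
    and \<beta>: "\<beta> \<in> H" "b \<in> L \<beta>" and ess\<beta>: "\<And>N. N \<in> \<M> \<Longrightarrow> \<beta> \<in> \<Union>N"
    using slot[OF b] by blast
  have "\<M> \<noteq> {}"
    using max_matchings_nonempty[OF slottedD(1)[OF S]] slottedD(3)[OF S \<tau>0(1)] by metis
  then obtain N0 where N0: "N0 \<in> \<M>" by blast
  obtain \<gamma> where \<gamma>: "{\<alpha>, \<gamma>} \<in> N0" "\<alpha> \<noteq> \<gamma>"
    using slotted_matched[OF E2 S \<tau>0(1) N0 ess\<alpha>[OF N0]] by blast
  define survives where "survives p x c \<longleftrightarrow> p \<in> B \<and> {token p, x} \<in> E \<and> x \<notin> visited p \<and>
    {x, c} \<in> E \<and> c \<notin> visited p \<and> c \<noteq> x" for p x c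
  consider (same) "\<alpha> = \<beta>"
    | (collapse_b) \<gamma>' N where "N \<in> \<M>" "{\<alpha>, \<gamma>'} \<in> N" "\<alpha> \<noteq> \<gamma>'" "\<And>p. \<not> survives p b (\<tau>0 \<gamma>')"
    | (collapse_a) \<delta> N where "N \<in> \<M>" "{\<beta>, \<delta>} \<in> N" "\<beta> \<noteq> \<delta>" "\<And>p. \<not> survives p a (\<tau>1 \<delta>)"
    | (twins) "\<alpha> \<noteq> \<beta>"
      "\<And>\<gamma>' N. \<lbrakk>N \<in> \<M>; {\<alpha>, \<gamma>'} \<in> N; \<alpha> \<noteq> \<gamma>'\<rbrakk> \<Longrightarrow> \<exists>p. survives p b (\<tau>0 \<gamma>')"
      "\<And>\<delta> N. \<lbrakk>N \<in> \<M>; {\<beta>, \<delta>} \<in> N; \<beta> \<noteq> \<delta>\<rbrakk> \<Longrightarrow> \<exists>p. survives p a (\<tau>1 \<delta>)"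
    by blast
  then show ?thesis
  proof cases
    case same
    show ?thesis
      by (rule reply_delete[OF V S R a(1) _ a(2) \<tau>0 N0 \<gamma>]) (use \<alpha> \<beta> same in auto)
  next
    case collapse_b
    show ?thesis
      by (rule reply_delete[OF V S R a(1) _ a(2) \<tau>0 collapse_b(1-3)])
        (use \<alpha> collapse_b(4) in \<open>auto simp: survives_def\<close>)
  next
    case collapse_a
    show ?thesis
      by (rule reply_delete[OF V S R b(1) _ b(2) \<tau>1 collapse_a(1-3)])
        (use \<beta> collapse_a(4) in \<open>auto simp: survives_def\<close>)
  next
    case twins
    let ?\<sigma> = "transpose \<alpha> \<beta>"
    \<comment> \<open>A survivor has both vertices unvisited before the two moves, so one section
      assigns them to different slots.\<close>
    have distinct: "k \<noteq> h" if s: "survives p x c" "h \<in> H" "x \<in> L h" "c \<in> L k" for p x c h k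
    proof
      assume "k = h"
      obtain \<tau> where \<tau>: "\<tau> \<in> Pi H L" "V - visited p = \<tau> ` H"
        using R s(1) by (auto simp: realizes_def survives_def)
      have "x \<in> \<tau> ` H" "c \<in> \<tau> ` H" "c \<noteq> x"
        using s(1) simple_graph_mem[OF V, of x c] \<tau>(2) unfolding survives_def by blast+
      moreover have "\<tau> h = x"
        using slotted_section_eq[OF S \<tau>(1) s(2,3)] calculation by simp
      moreover have "\<tau> h = c"
        using slotted_section_eq[OF S \<tau>(1) s(2)] s(4) \<open>k = h\<close> calculation by simp
      ultimately show False by simp
    qed
    \<comment> \<open>A realization surviving \<open>b\<close> and then
      \<open>\<tau>0 \<gamma>'\<close> witnesses the edge that the exchange needs;
      \<open>a_partner\<close> is symmetric.\<close>
    have b_partner: "\<gamma>' \<noteq> \<beta> \<and> {b, \<tau>0 \<gamma>'} \<in> E" if N: "N \<in> \<M>" "{\<alpha>, \<gamma>'} \<in> N" "\<alpha> \<noteq> \<gamma>'" for \<gamma>' N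
    proof -
      obtain p where p: "survives p b (\<tau>0 \<gamma>')" using twins(2)[OF N] by blast
      have "\<gamma>' \<in> H" using slotted_edge[OF S \<tau>0(1) N(1,2)] by simp
      then have "\<tau>0 \<gamma>' \<in> L \<gamma>'" using \<tau>0(1) by auto
      then show ?thesis using distinct[OF p \<beta>] p by (auto simp: survives_def)
    qed
    have a_partner: "\<delta> \<noteq> \<alpha> \<and> {a, \<tau>1 \<delta>} \<in> E" if N: "N \<in> \<M>" "{\<beta>, \<delta>} \<in> N" "\<beta> \<noteq> \<delta>" for \<delta> N
    proof -
      obtain p where p: "survives p a (\<tau>1 \<delta>)" using twins(3)[OF N] by blast
      have "\<delta> \<in> H" using slotted_edge[OF S \<tau>1(1) N(1,2)] by simp
      then have "\<tau>1 \<delta> \<in> L \<delta>" using \<tau>1(1) by auto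
      then show ?thesis using distinct[OF p \<alpha>] p by (auto simp: survives_def)
    qed
    have swap: "(`) ?\<sigma> ` N \<in> \<M>" if N: "N \<in> \<M>" for N
    proof -
      obtain \<gamma>' where \<gamma>': "{\<alpha>, \<gamma>'} \<in> N" "\<alpha> \<noteq> \<gamma>'"
        using slotted_matched[OF E2 S \<tau>0(1) N ess\<alpha>[OF N]] by blast
      obtain \<delta> where \<delta>: "{\<beta>, \<delta>} \<in> N" "\<beta> \<noteq> \<delta>"
        using slotted_matched[OF E2 S \<tau>0(1) N ess\<beta>[OF N]] by blast
      note bp = b_partner[OF N \<gamma>'] and ap = a_partner[OF N \<delta>]
      have "\<delta> \<in> H" using slotted_edge[OF S \<tau>1(1) N \<delta>(1)] by simp
      \<comment> \<open>This section combines labels from the realizations \<open>pa\<close> and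
        \<open>pb\<close>, so that both exchanged edges are present in one pulled-back
        graph.\<close>
      let ?\<tau> = "\<tau>0(\<beta> := b, \<delta> := \<tau>1 \<delta>)"
      have sec: "?\<tau> \<in> Pi H L" using \<tau>0(1) \<tau>1(1) \<beta> \<open>\<delta> \<in> H\<close> by (auto simp: Pi_def)
      note mm = slottedD(3)[OF S sec]
      have "disjoint N"
        using N unfolding mm[symmetric] by (simp add: max_matchings_def matching_def)
      moreover have "{\<alpha>, \<gamma>'} \<noteq> {\<beta>, \<delta>}" using twins(1) ap by (auto simp: doubleton_eq_iff)
      ultimately have "{\<alpha>, \<gamma>'} \<inter> {\<beta>, \<delta>} = {}"
        using \<gamma>'(1) \<delta>(1) by (intro disjointD)
      \<comment> \<open>Hence the update at \<delta> leaves the label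
        \<open>\<tau>0 \<gamma>'\<close> on the slot \<open>\<gamma>'\<close>.\<close>
      then have "\<gamma>' \<noteq> \<delta>" by blast
      have "(`) ?\<sigma> ` N \<in> max_matchings {e. ?\<tau> ` e \<in> E} H"
      proof (rule max_matchings_exchange[OF _ \<gamma>'(1) \<delta>(1) twins(1) \<gamma>'(2)])
        show "N \<in> max_matchings {e. ?\<tau> ` e \<in> E} H" using N mm by simp
        show "\<alpha> \<noteq> \<delta>" "\<beta> \<noteq> \<gamma>'" "\<beta> \<noteq> \<delta>" using ap bp \<delta>(2) by auto
        have "?\<tau> ` {\<alpha>, \<delta>} = {a, \<tau>1 \<delta>}" using twins(1) ap \<tau>0(3) by auto
        then show "{\<alpha>, \<delta>} \<in> {e. ?\<tau> ` e \<in> E}" using ap by simp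
        have "?\<tau> ` {\<beta>, \<gamma>'} = {b, \<tau>0 \<gamma>'}" using bp \<delta>(2) \<open>\<gamma>' \<noteq> \<delta>\<close> by auto
        then show "{\<beta>, \<gamma>'} \<in> {e. ?\<tau> ` e \<in> E}" using bp by simp
      qed
      then show ?thesis using mm by simp
    qed
    have \<gamma>H: "\<gamma> \<in> H" and "\<beta> \<noteq> \<gamma>" and c: "\<tau>0 \<gamma> \<in> L \<gamma>"
      using slotted_edge[OF S \<tau>0(1) N0 \<gamma>(1)] b_partner[OF N0 \<gamma>] \<tau>0(1) by auto
    have \<sigma>edge: "?\<sigma> ` {\<alpha>, \<gamma>} = {\<beta>, \<gamma>}" "?\<sigma> ` {\<beta>, \<gamma>} = {\<alpha>, \<gamma>}"
      using \<gamma>(2) \<open>\<beta> \<noteq> \<gamma>\<close> by (auto simp: transpose_def)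
    \<comment> \<open>The swapped matching pairs \<beta> with the same \<gamma>, so one reply serves
      both deletions.\<close>
    have "?\<sigma> ` {\<alpha>, \<gamma>} \<in> (`) ?\<sigma> ` N0" using \<gamma>(1) by (rule imageI)
    then have \<beta>\<gamma>: "{\<beta>, \<gamma>} \<in> (`) ?\<sigma> ` N0" unfolding \<sigma>edge .
    have inj: "inj ?\<sigma>" by (metis injI transpose_involutory)
    have link_iff: "N \<in> link {\<beta>, \<gamma>} \<M> \<longleftrightarrow> (`) ?\<sigma> ` N \<in> link {\<alpha>, \<gamma>} \<M>" for N
    proof -
      have "(`) ?\<sigma> ` (`) ?\<sigma> ` N = N" by (simp add: image_image)
      then show ?thesis
        using link_image[OF inj swap, of N "{\<beta>, \<gamma>}"] link_image[OF inj swap, of "(`) ?\<sigma> ` N" "{\<alpha>, \<gamma>}"]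
        unfolding \<sigma>edge by auto
    qed
    let ?H = "H - {\<beta>, \<gamma>}" and ?L = "L(\<alpha> := L \<alpha> \<union> L \<beta>)"
    have S': "slotted E ?H ?L (\<tau>0 \<gamma>) (link {\<beta>, \<gamma>} \<M>)"
    proof (rule slotted_merge[OF _ _ _ \<alpha>(1) \<beta>(1) twins(1) \<gamma>(2) \<open>\<beta> \<noteq> \<gamma>\<close> link_iff])
      show "slotted E (H - {\<beta>, \<gamma>}) L (\<tau>0 \<gamma>) (link {\<beta>, \<gamma>} \<M>)"
        by (rule slotted_delete[OF S \<tau>0(1) swap[OF N0] \<beta>\<gamma> \<open>\<beta> \<noteq> \<gamma>\<close> ess\<beta>])
      show "slotted E (H - {\<alpha>, \<gamma>}) L (\<tau>0 \<gamma>) (link {\<alpha>, \<gamma>} \<M>)"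
        by (rule slotted_delete[OF S \<tau>0(1) N0 \<gamma> ess\<alpha>])
      show "disjoint_family_on L H" using S by (simp add: slotted_def)
    qed
    have "realizes V ?H ?L (\<tau>0 \<gamma>) (results E (results E B {a, b}) {\<tau>0 \<gamma>})"
      unfolding realizes_def
    proof
      fix q assume "q \<in> results E (results E B {a, b}) {\<tau>0 \<gamma>}"
      then obtain p x where q: "p \<in> B" "x \<in> {a, b}" "{token p, x} \<in> E" "x \<notin> visited p"
        "{x, \<tau>0 \<gamma>} \<in> E" "\<tau>0 \<gamma> \<notin> visited p" "\<tau>0 \<gamma> \<noteq> x"
        "q = UG (insert (\<tau>0 \<gamma>) (insert x (visited p))) (\<tau>0 \<gamma>)"
        by (rule results_two_steps)
      obtain \<tau> where \<tau>: "\<tau> \<in> Pi H L" "V - visited p = \<tau> ` H"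
        using R q(1) by (auto simp: realizes_def)
      note \<tau>inj = slotted_section_inj[OF S \<tau>(1)]
      have xH: "x \<in> \<tau> ` H" and "\<tau>0 \<gamma> \<in> \<tau> ` H"
        using \<tau>(2) simple_graph_mem[OF V q(5)] q(4,6) by blast+
      then have \<tau>\<gamma>: "\<tau> \<gamma> = \<tau>0 \<gamma>"
        using slotted_section_eq[OF S \<tau>(1) \<gamma>H c] by blast
      have vis: "V - visited q = \<tau> ` (H - {h, \<gamma>})" if "h \<in> H" "x \<in> L h" for h
      proof -
        have "\<tau> h = x" using slotted_section_eq[OF S \<tau>(1) that xH] .
        then have "V - visited q = \<tau> ` H - \<tau> ` {h, \<gamma>}"
          using q(8) \<tau>(2) \<tau>\<gamma> by auto
        also have "\<dots> = \<tau> ` (H - {h, \<gamma>})"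
          using inj_on_image_set_diff[OF \<tau>inj, of H "{h, \<gamma>}"] that(1) \<gamma>H by auto
        finally show ?thesis .
      qed
      have "\<exists>\<tau>'\<in>Pi ?H ?L. V - visited q = \<tau>' ` ?H"
      proof (cases "x = b")
        case True
        then have "V - visited q = \<tau> ` ?H" using vis \<beta> by blast
        moreover have "\<tau> \<in> Pi ?H ?L" using \<tau>(1) by (auto simp: Pi_def)
        ultimately show ?thesis by blast
      next
        case False
        then have "V - visited q = \<tau> ` (H - {\<alpha>, \<gamma>})" using vis \<alpha> q(2) by blast
        \<comment> \<open>Here \<open>a\<close> has been visited; the vertex still unvisited in slot
          \<beta> moves into the merged slot, which is named \<alpha>.\<close>
        also have "\<dots> = (\<tau>(\<alpha> := \<tau> \<beta>)) ` ?H"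
          using \<alpha>(1) \<beta>(1) twins(1) \<gamma>(2) \<open>\<beta> \<noteq> \<gamma>\<close> by (auto simp: image_iff)
        finally have "V - visited q = (\<tau>(\<alpha> := \<tau> \<beta>)) ` ?H" .
        moreover have "\<tau>(\<alpha> := \<tau> \<beta>) \<in> Pi ?H ?L" using \<tau>(1) \<beta>(1) by (auto simp: Pi_def)
        ultimately show ?thesis by blast
      qed
      then show "token q = \<tau>0 \<gamma> \<and> (\<exists>\<tau>'\<in>Pi ?H ?L. V - visited q = \<tau>' ` ?H)"
        using q(8) by simp
    qed
    moreover have "card ?H < card H"
      using slottedD(1)[OF S] \<beta>(1) by (intro psubset_card_mono) auto
    moreover have "\<exists>q\<in>results E B {a, b}. feasible (ug_step E) q (\<tau>0 \<gamma>)"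
      by (rule reply_feasible[OF V S a(1) _ a(2) \<tau>0 N0 \<gamma>]) simp
    ultimately show ?thesis using S' unfolding good_reply_def by blast
  qed
qed

section \<open>Outcome classes from essential neighbours\<close>

lemma slotted_quantum_P:
  assumes V: "simple_graph V E"
  shows "slotted E H L t \<M> \<Longrightarrow> realizes V H L t B \<Longrightarrow>
    has_outcome (quantum_opts_D (ug_step E)) B P_class"
proof (induction "card H" arbitrary: H L t \<M> B rule: less_induct)
  case less
  show ?case
  proof (rule has_outcome.P)
    fix C assume "C \<in> quantum_opts_D (ug_step E) B"
    then obtain m where m: "legal_D (ug_step E) B m" "C = qresult (ug_step E) B m"
      by (auto simp: quantum_opts_D_def)
    have "\<exists>a b. C = results E B {a, b} \<and> (\<exists>p\<in>B. feasible (ug_step E) p a) \<and>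
        (\<exists>p\<in>B. feasible (ug_step E) p b)"
    proof (cases m)
      case (Classical v)
      then have "C = results E B {v, v}" using m(2) by (auto simp: results_def)
      then show ?thesis using m(1) Classical by (metis legal_D.simps(1))
    next
      case (Quantum v w)
      then have "C = results E B {v, w}" using m(2) by (simp add: results_def)
      then show ?thesis using m(1) Quantum by (metis legal_D.simps(2))
    qed
    then obtain a b pa pb where C: "C = results E B {a, b}"
      and ab: "pa \<in> B" "feasible (ug_step E) pa a" "pb \<in> B" "feasible (ug_step E) pb b"
      by blast
    obtain c H' L' \<M>' where reply: "\<exists>q\<in>C. feasible (ug_step E) q c"
      "slotted E H' L' c \<M>'" "card H' < card H" "realizes V H' L' c (results E C {c})"
      using good_reply_exists[OF V less.prems ab] unfolding good_reply_def C by blast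
    have "results E C {c} = qresult (ug_step E) C (Classical c)"
      by (auto simp: results_def)
    moreover have "legal_D (ug_step E) C (Classical c)" using reply(1) by simp
    ultimately have "results E C {c} \<in> quantum_opts_D (ug_step E) C"
      unfolding quantum_opts_D_def by blast
    then show "has_outcome (quantum_opts_D (ug_step E)) C N_class"
      using less.hyps[OF reply(3,2,4)] by (rule has_outcome.N)
  qed
qed

text \<open>In Gallai-Edmonds terms: the token has no neighbour in the set of unvisited vertices
  missed by some maximum matching of the unvisited graph.\<close>

definition neighbours_essential :: "'a set \<Rightarrow> 'a set set \<Rightarrow> 'a ug_position \<Rightarrow> bool" where
  "neighbours_essential V E p \<longleftrightarrow> (\<forall>v\<in>V - visited p. {token p, v} \<in> E \<longrightarrow>
     (\<forall>N\<in>max_matchings E (V - visited p). v \<in> \<Union>N))"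

text \<open>Initially each unvisited vertex is its own slot with itself as the only label, so every
  section is the identity on the slots.\<close>

lemma neighbours_essential_quantum_P:
  assumes V: "simple_graph V E" and p: "neighbours_essential V E p"
  shows "has_outcome (quantum_opts_D (ug_step E)) {p} P_class"
proof (rule slotted_quantum_P[OF V])
  let ?H = "V - visited p"
  show "realizes V ?H (\<lambda>v. {v}) (token p) {p}"
    by (auto simp: realizes_def intro!: bexI[of _ id])
  have "max_matchings {e. \<tau> ` e \<in> E} ?H = max_matchings E ?H" if "\<tau> \<in> Pi ?H (\<lambda>v. {v})" for \<tau>
  proof (rule max_matchings_cong)
    fix e assume "e \<subseteq> ?H"
    then have "\<tau> ` e = id ` e" using that by (intro image_cong) (auto simp: Pi_def)
    then show "e \<in> {e. \<tau> ` e \<in> E} \<longleftrightarrow> e \<in> E" by simp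
  qed
  then show "slotted E ?H (\<lambda>v. {v}) (token p) (max_matchings E ?H)"
    using V p by (auto simp: slotted_def simple_graph_def disjoint_family_on_def neighbours_essential_def)
qed

text \<open>A move to \<open>a\<close> is answered by its partner in any maximum matching, after
  which the neighbours of the new token are again essential.\<close>

lemma neighbours_essential_classical_P:
  assumes V: "simple_graph V E"
  shows "neighbours_essential V E p \<Longrightarrow> has_outcome (classical_opts (ug_step E)) p P_class"
proof (induction "card (V - visited p)" arbitrary: p rule: less_induct)
  case less
  let ?H = "V - visited p"
  have fin: "finite ?H" using V by (simp add: simple_graph_def)
  show ?case
  proof (rule has_outcome.P)
    fix q assume "q \<in> classical_opts (ug_step E) p"
    then obtain a where a: "feasible (ug_step E) p a" "q = the (ug_step E p a)"
      by (auto simp: classical_opts_def)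
    then have q: "q = UG (insert a (visited p)) a" by (simp add: ug_step_result)
    have "a \<in> ?H" using a(1) simple_graph_mem[OF V] by (auto simp: feasible_ug_iff)
    then have ess: "a \<in> \<Union>N" if "N \<in> max_matchings E ?H" for N
      using less.prems a(1) that by (auto simp: neighbours_essential_def feasible_ug_iff)
    obtain N where N: "N \<in> max_matchings E ?H"
      using max_matchings_nonempty[OF fin] by blast
    then obtain e where e: "e \<in> N" "a \<in> e" using ess by blast
    have eE: "e \<in> E" "e \<subseteq> ?H" using N e(1) by (auto simp: max_matchings_def matching_def)
    then have "card e = 2" using V by (simp add: simple_graph_def)
    then obtain c where c: "e = {a, c}" "a \<noteq> c" using e(2) by (auto simp: card_2_iff)
    have feas: "feasible (ug_step E) q c" using c eE by (auto simp: feasible_ug_iff q)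
    let ?r = "UG (insert c (insert a (visited p))) c"
    have r: "the (ug_step E q c) = ?r" using ug_step_result[OF feas] q by simp
    have rH: "V - visited ?r = ?H - {a, c}" by auto
    have "neighbours_essential V E ?r"
      unfolding neighbours_essential_def rH
    proof (intro ballI impI)
      fix v N' assume v: "v \<in> ?H - {a, c}" "{token ?r, v} \<in> E" "N' \<in> max_matchings E (?H - {a, c})"
      show "v \<in> \<Union>N'"
        by (rule max_matchings_delete_edge_covers[OF fin N _ c(2) ess v(1) _ v(3)])
          (use e c v in auto)
    qed
    moreover have "card (V - visited ?r) < card ?H"
      unfolding rH using fin \<open>a \<in> ?H\<close> by (intro psubset_card_mono) auto
    ultimately have "has_outcome (classical_opts (ug_step E)) ?r P_class"
      using less.hyps by blast
    moreover have "?r \<in> classical_opts (ug_step E) q"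
      using feas r unfolding classical_opts_def by force
    ultimately show "has_outcome (classical_opts (ug_step E)) q N_class"
      by (blast intro: has_outcome.N)
  qed
qed

text \<open>The winning move goes to a neighbour that some maximum matching leaves exposed.\<close>

lemma option_neighbours_essential:
  assumes V: "simple_graph V E" and p: "\<not> neighbours_essential V E p"
  obtains v where "feasible (ug_step E) p v" "neighbours_essential V E (the (ug_step E p v))"
proof -
  let ?H = "V - visited p"
  have fin: "finite ?H" using V by (simp add: simple_graph_def)
  obtain v N where v: "v \<in> ?H" "{token p, v} \<in> E" "N \<in> max_matchings E ?H" "v \<notin> \<Union>N"
    using p unfolding neighbours_essential_def by blast
  have feas: "feasible (ug_step E) p v" using v by (simp add: feasible_ug_iff)
  let ?q = "UG (insert v (visited p)) v"
  have qH: "V - visited ?q = ?H - {v}" by auto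
  have "neighbours_essential V E ?q"
    unfolding neighbours_essential_def qH
    using max_matchings_delete_exposed_covers[OF fin v(3,1,4)] by auto
  then show ?thesis using that feas ug_step_result[OF feas] by simp
qed

theorem mainTheorem3:
  fixes V :: "'a set" and E :: "'a set set" and p :: "'a ug_position"
  assumes "simple_graph V E"
    and "ug_position V p"
  shows "outcome_class (classical_opts (ug_step E)) p =
         outcome_class (quantum_opts_D (ug_step E)) {p}"
proof -
  have "\<exists>c. has_outcome (classical_opts (ug_step E)) p c \<and>
      has_outcome (quantum_opts_D (ug_step E)) {p} c"
  proof (cases "neighbours_essential V E p")
    case True
    then show ?thesis
      using neighbours_essential_classical_P neighbours_essential_quantum_P assms(1) by blast
  next
    case False
    then obtain v where v: "feasible (ug_step E) p v"
      "neighbours_essential V E (the (ug_step E p v))"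
      using option_neighbours_essential[OF assms(1)] by blast
    let ?q = "the (ug_step E p v)"
    have "?q \<in> classical_opts (ug_step E) p"
      using v(1) by (auto simp: classical_opts_def)
    \<comment> \<open>Played classically on a single realization, the winning move leads to a single
      realization, so the same option wins both games.\<close>
    moreover have "{?q} \<in> quantum_opts_D (ug_step E) {p}"
    proof -
      have "{?q} = qresult (ug_step E) {p} (Classical v)" using v(1) by auto
      moreover have "legal_D (ug_step E) {p} (Classical v)" using v(1) by simp
      ultimately show ?thesis unfolding quantum_opts_D_def by blast
    qed
    ultimately show ?thesis
      using neighbours_essential_classical_P[OF assms(1) v(2)]
        neighbours_essential_quantum_P[OF assms(1) v(2)]
      by (blast intro: has_outcome.N)
  qed
  then show ?thesis
    using ug_outcome_class[OF assms(1)] qug_outcome_class[OF assms(1)] by metis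
qed

end
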